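(* Let $k\ge 1$ and $n \ge 2k+1$ be integers. If $\mathcal{B}$ and $\mathcal{C}$ are two cross-intersecting families of $k$-element subsets of $[n]=\{1,\dots,n\}$, then $$\delta_{1}(\mathcal{B})\, \delta_{1}(\mathcal{C}) \le \binom{n-2}{k-2}^2.$$
   Context: Two families $\mathcal{B}$ and $\mathcal{C}$ of $k$-element subsets of $[n]$ are cross-intersecting if $B\cap C\neq\emptyset$ for every $B\in\mathcal{B}$ and every $C\in\mathcal{C}$. For a family $\mathcal{F}$ of $k$-element subsets of $[n]$ (viewed as a $k$-uniform hypergraph with vertex set $[n]$), the degree of $i\in[n]$ is the number of members of $\mathcal{F}$ containing $i$, and $\delta_1(\mathcal{F})$ is the minimum of the degrees over all $i\in[n]$. Convention: $\binom{m}{-1}=0$. *)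

theory Defs
  imports "HOL-Library.Ramsey"
begin

definition cross_intersecting :: "'a set set \<Rightarrow> 'a set set \<Rightarrow> bool" where
  "cross_intersecting \<B> \<C> \<longleftrightarrow> (\<forall>B\<in>\<B>. \<forall>C\<in>\<C>. B \<inter> C \<noteq> {})"

definition vertex_degree :: "'a set set \<Rightarrow> 'a \<Rightarrow> nat" where
  "vertex_degree \<F> i = card {F \<in> \<F>. i \<in> F}"

text \<open>The vertex set is an explicit argument: vertices lying in no member of the family count,
  with degree 0. It is meant to be finite and nonempty.\<close>

definition min_degree :: "'a set \<Rightarrow> 'a set set \<Rightarrow> nat" where
  "min_degree V \<F> = Min (vertex_degree \<F> ` V)"

text \<open>Binomial coefficient with an integer lower index, 0 when that index is negative. With
  natural-number subtraction, \<open>(n - 2) choose (k - 2)\<close> would be 1 instead of 0 for \<open>k = 1\<close>.\<close>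

definition binom :: "nat \<Rightarrow> int \<Rightarrow> nat" where
  "binom m j = (if j < 0 then 0 else m choose nat j)"

end

theory Submission
  imports Defs "HOL-Analysis.Convex"
begin

text \<open>
  The proof is a weighted Hoffman bound for the Kneser graph on the \<open>k\<close>-subsets of \<open>V\<close>, where \<open>card V = n\<close>
  and sets are adjacent iff they are disjoint. Let \<open>A\<close> be its adjacency operator. Cross-intersection of
  \<open>\<F>\<close> and \<open>\<G>\<close> says that the indicators satisfy \<open>\<langle>f, A g\<rangle> = 0\<close>.

  Write \<open>f = f\<^sub>0 + f\<^sub>1 + f\<^sub>2\<close>, where \<open>f\<^sub>0\<close> is the constant \<open>b / (n choose k)\<close> with \<open>b = card \<F>\<close>, the
  function \<open>f\<^sub>1\<close> is the sum over the points of a set of weights proportional to the deviations of the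
  degrees from their average \<open>k b / n\<close>, and \<open>f\<^sub>2\<close> is orthogonal to all constants and to the indicators of
  the stars of all points. These three parts lie in different invariant spaces of \<open>A\<close>. On the first two \<open>A\<close> acts by
  \<open>(n - k) choose k\<close> and by \<open>- ((n - k - 1) choose (k - 1))\<close>, and on the third its norm is at most
  \<open>(n - k - 2) choose (k - 2)\<close>. Writing \<open>F\<^sub>i\<close> for the squared norm of \<open>f\<^sub>i\<close> divided by that of \<open>f\<^sub>0\<close>, and
  \<open>G\<^sub>i\<close> for the same quantity for \<open>\<G>\<close>, the equation \<open>\<langle>f, A g\<rangle> = 0\<close> gives, after division by the
  eigenvalue \<open>(n - k) choose k\<close>, by Cauchy-Schwarz and \<open>k \<le> n - k - 1\<close>,
  \<open>n - k \<le> k * sqrt (F\<^sub>1 G\<^sub>1) + (k - 1) * sqrt (F\<^sub>2 G\<^sub>2)\<close>.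

  The minimum degree \<open>\<delta>\<close> of \<open>\<F>\<close> enters through \<open>\<delta> \<le> d i \<le> b\<close>: summing \<open>(b - d i) * (d i - \<delta>) \<ge> 0\<close> bounds
  the variance of the degrees, hence \<open>F\<^sub>1\<close>. With \<open>a\<close> the multiple of \<open>\<delta>\<close> that equals \<open>k - 1\<close> when
  \<open>\<delta> = (n - 2) choose (k - 2)\<close>, this reads \<open>(1 + a) F\<^sub>1 + a F\<^sub>2 \<le> n - 1 - a\<close> (lemma \<open>weight_bound\<close>), and similarly
  for \<open>\<G>\<close> with some \<open>a'\<close>. If \<open>a a' > (k - 1)\<^sup>2\<close>, then by Cauchy-Schwarz the right-hand side above is at most
  \<open>sqrt ((n - 1 - a) (n - 1 - a')) \<le> n - 1 - sqrt (a a') < n - k\<close>, a contradiction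
  (lemma \<open>two_level_optimisation\<close>). So \<open>a a' \<le> (k - 1)\<^sup>2\<close>, which is the claim.

  The norm bound for the third part comes from star sums. The star of \<open>J\<close> consists of the \<open>k\<close>-sets that
  contain \<open>J\<close>. If the sums of \<open>f\<close> over the stars of all sets with fewer than \<open>j\<close> points vanish, then inclusion-exclusion gives that the star sums of \<open>A f\<close>
  at \<open>j\<close>-sets are \<open>(-1)\<^sup>j ((n - k - j) choose (k - j))\<close> times those of \<open>f\<close>. So subtracting this multiple of \<open>f\<close> from
  \<open>A f\<close> gains one more level of vanishing, and after level \<open>k\<close> nothing is left. As the eigenvalues are
  distinct for \<open>n > 2 k\<close>, this splits \<open>f\<close> into eigenvectors, which are orthogonal because \<open>A\<close> is symmetric.

  For \<open>k = 1\<close> the binomial coefficient is zero and the claim is that not both families cover all points.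
\<close>

section \<open>Inclusion-exclusion and counting of supersets\<close>

lemma prod_of_bool: "finite A \<Longrightarrow> (\<Prod>x\<in>A. of_bool (P x)) = (of_bool (\<forall>x\<in>A. P x) :: real)"
  by (induction A rule: finite_induct) auto

text \<open>Inclusion-exclusion, read off by expanding the product of \<open>1 - of_bool (x \<in> S)\<close> over \<open>x \<in> J\<close>.\<close>

lemma of_bool_disjoint_eq_alternating_sum:
  assumes "finite J"
  shows "of_bool (S \<inter> J = {}) = (\<Sum>I\<in>Pow J. (-1) ^ card I * of_bool (I \<subseteq> S) :: real)"
proof -
  have "of_bool (S \<inter> J = {}) = (\<Prod>x\<in>J. 1 - of_bool (x \<in> S) :: real)"
  proof -
    have "(\<Prod>x\<in>J. 1 - of_bool (x \<in> S) :: real) = (\<Prod>x\<in>J. of_bool (x \<notin> S))"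
      by (intro prod.cong) auto
    also have "\<dots> = of_bool (\<forall>x\<in>J. x \<notin> S)" using assms by (rule prod_of_bool)
    also have "(\<forall>x\<in>J. x \<notin> S) \<longleftrightarrow> S \<inter> J = {}" by blast
    finally show ?thesis by simp
  qed
  also have "\<dots> = (\<Sum>I\<in>Pow J. (-1) ^ card I * (\<Prod>x\<in>I. of_bool (x \<in> S)) * (\<Prod>x\<in>J - I. 1))"
    using assms by (rule prod_diff_conv_sum)
  also have "\<dots> = (\<Sum>I\<in>Pow J. (-1) ^ card I * of_bool (I \<subseteq> S))"
  proof (intro sum.cong refl)
    fix I assume "I \<in> Pow J"
    then have "finite I" using assms finite_subset by auto
    then show "(-1) ^ card I * (\<Prod>x\<in>I. of_bool (x \<in> S)) * (\<Prod>x\<in>J - I. 1)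
      = (-1) ^ card I * (of_bool (I \<subseteq> S) :: real)"
      by (simp add: prod_of_bool subset_eq)
  qed
  finally show ?thesis .
qed

lemma card_nsets_superset:
  assumes "finite W" "J \<subseteq> W" "card J \<le> k"
  shows "card {T \<in> [W]\<^bsup>k\<^esup>. J \<subseteq> T} = (card W - card J) choose (k - card J)"
proof -
  have fJ: "finite J" using assms finite_subset by auto
  have "bij_betw (\<lambda>T. T \<union> J) (nsets (W - J) (k - card J)) {T \<in> [W]\<^bsup>k\<^esup>. J \<subseteq> T}"
  proof (rule bij_betw_byWitness[where f' = "\<lambda>T. T - J"])
    show "(\<lambda>T. T \<union> J) ` nsets (W - J) (k - card J) \<subseteq> {T \<in> [W]\<^bsup>k\<^esup>. J \<subseteq> T}"
    proof (clarsimp simp: nsets_def)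
      fix T assume T: "T \<subseteq> W - J" "finite T" "card T = k - card J"
      then have "card (T \<union> J) = card T + card J"
        using fJ by (intro card_Un_disjoint) auto
      then show "T \<subseteq> W \<and> J \<subseteq> W \<and> finite J \<and> card (T \<union> J) = k"
        using T assms fJ by auto
    qed
    show "(\<lambda>T. T - J) ` {T \<in> [W]\<^bsup>k\<^esup>. J \<subseteq> T} \<subseteq> nsets (W - J) (k - card J)"
      using fJ by (auto simp: nsets_def card_Diff_subset)
  qed (auto simp: nsets_def)
  then have "card {T \<in> [W]\<^bsup>k\<^esup>. J \<subseteq> T} = card (nsets (W - J) (k - card J))"
    by (rule bij_betw_same_card[symmetric])
  also have "\<dots> = (card W - card J) choose (k - card J)"
    using assms fJ by (simp add: card_Diff_subset)
  finally show ?thesis .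
qed

section \<open>Two inequalities over the reals\<close>

text \<open>The reason is that \<open>(b - d i) * (d i - \<delta>) \<ge> 0\<close> for each \<open>i\<close>. The bound is attained when every \<open>d i\<close> is
  \<open>b\<close> or \<open>\<delta>\<close>, as it is for the degrees of a full star; this is why the final estimate loses nothing there.\<close>

lemma sum_square_deviation_le:
  fixes d :: "'a \<Rightarrow> real" and b \<delta> k n :: real
  assumes "card V = n" "0 < n" "(\<Sum>i\<in>V. d i) = k * b"
    and "\<And>i. i \<in> V \<Longrightarrow> \<delta> \<le> d i" "\<And>i. i \<in> V \<Longrightarrow> d i \<le> b"
  shows "(\<Sum>i\<in>V. (d i - k * b / n)\<^sup>2) \<le> b * (n - k) * (k * b - n * \<delta>) / n"
proof -
  have "(\<Sum>i\<in>V. (d i - k * b / n)\<^sup>2)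
      = (\<Sum>i\<in>V. ((b + \<delta> - 2 * (k * b / n)) * d i + ((k * b / n)\<^sup>2 - b * \<delta>)) - (b - d i) * (d i - \<delta>))"
    by (intro sum.cong refl) (simp add: power2_eq_square algebra_simps)
  also have "\<dots> = (b + \<delta> - 2 * (k * b / n)) * (k * b) + n * ((k * b / n)\<^sup>2 - b * \<delta>)
      - (\<Sum>i\<in>V. (b - d i) * (d i - \<delta>))"
    using assms(1,3) by (simp add: sum_subtractf sum.distrib sum_distrib_left[symmetric])
  also have "\<dots> \<le> (b + \<delta> - 2 * (k * b / n)) * (k * b) + n * ((k * b / n)\<^sup>2 - b * \<delta>)"
    using assms(4,5) by (simp add: sum_nonneg)
  also have "\<dots> = b * (n - k) * (k * b - n * \<delta>) / n"
    using assms(2) by (simp add: field_simps power2_eq_square)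
  finally show ?thesis .
qed

text \<open>The coefficients \<open>\<kappa> + 1\<close> and \<open>\<kappa>\<close> of the square roots are dominated, if \<open>\<kappa>\<^sup>2 < a * b\<close>, by
  \<open>sqrt ((1 + a) * (1 + b))\<close> and \<open>sqrt (a * b)\<close>. With these coefficients Cauchy-Schwarz turns the two linear
  constraints into the upper bound \<open>sqrt ((m - a) * (m - b))\<close>, which by the inequality of arithmetic and
  geometric means is at most \<open>m - sqrt (a * b)\<close>.\<close>

lemma two_level_optimisation:
  fixes a b m \<kappa> F1 F2 G1 G2 :: real
  assumes nonneg: "0 \<le> a" "0 \<le> b" "0 \<le> F1" "0 \<le> F2" "0 \<le> G1" "0 \<le> G2" "0 \<le> \<kappa>"
    and "\<kappa> < m"
    and F: "(1 + a) * F1 + a * F2 \<le> m - a" and G: "(1 + b) * G1 + b * G2 \<le> m - b"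
    and bound: "m - \<kappa> \<le> (\<kappa> + 1) * sqrt (F1 * G1) + \<kappa> * sqrt (F2 * G2)"
  shows "a * b \<le> \<kappa>\<^sup>2"
proof (rule ccontr)
  assume "\<not> a * b \<le> \<kappa>\<^sup>2"
  then have k: "\<kappa> < sqrt (a * b)" by (simp add: real_less_rsqrt)
  let ?s = "sqrt (a * b)"
  have s2: "?s\<^sup>2 = a * b" using nonneg by simp
  have amgm: "2 * ?s \<le> a + b"
    using arith_geo_mean_sqrt[OF nonneg(1,2)] by simp
  have "(\<kappa> + 1)\<^sup>2 \<le> (?s + 1)\<^sup>2" using k nonneg by (intro power_mono) auto
  also have "\<dots> \<le> (1 + a) * (1 + b)" using amgm s2 by (simp add: power2_eq_square algebra_simps)
  finally have k1: "\<kappa> + 1 \<le> sqrt ((1 + a) * (1 + b))" by (rule real_le_rsqrt)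
  have "m - \<kappa> \<le> sqrt ((1 + a) * (1 + b)) * sqrt (F1 * G1) + ?s * sqrt (F2 * G2)"
    using bound mult_right_mono[OF k1, of "sqrt (F1 * G1)"]
      mult_right_mono[OF less_imp_le[OF k], of "sqrt (F2 * G2)"] nonneg by simp
  also have "\<dots> = sqrt ((1 + a) * F1) * sqrt ((1 + b) * G1) + sqrt (a * F2) * sqrt (b * G2)"
    by (simp add: real_sqrt_mult mult_ac)
  also have "\<dots> \<le> sqrt ((m - a) * (m - b))"
  proof -
    have "(sqrt ((1 + a) * F1) * sqrt ((1 + b) * G1) + sqrt (a * F2) * sqrt (b * G2))\<^sup>2
        \<le> ((1 + a) * F1 + a * F2) * ((1 + b) * G1 + b * G2)"
    proof -
      have cs: "(x * y + z * w)\<^sup>2 \<le> (x\<^sup>2 + z\<^sup>2) * (y\<^sup>2 + w\<^sup>2)" for x y z w :: real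
      proof -
        have "(x\<^sup>2 + z\<^sup>2) * (y\<^sup>2 + w\<^sup>2) - (x * y + z * w)\<^sup>2 = (x * w - y * z)\<^sup>2"
          by (simp add: power2_eq_square algebra_simps)
        then show ?thesis using zero_le_power2[of "x * w - y * z"] by linarith
      qed
      show ?thesis
        using cs[of "sqrt ((1 + a) * F1)" "sqrt ((1 + b) * G1)" "sqrt (a * F2)" "sqrt (b * G2)"] nonneg
        by simp
    qed
    also have "\<dots> \<le> (m - a) * (m - b)"
    proof (rule mult_mono[OF F G])
      have "0 \<le> (1 + a) * F1 + a * F2" "0 \<le> (1 + b) * G1 + b * G2" using nonneg by simp_all
      then show "0 \<le> m - a" "0 \<le> (1 + b) * G1 + b * G2" using F by linarith+
    qed
    finally show ?thesis by (rule real_le_rsqrt)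
  qed
  also have "\<dots> \<le> m - ?s"
  proof (rule real_le_lsqrt)
    have "0 \<le> (1 + a) * F1 + a * F2" "0 \<le> (1 + b) * G1 + b * G2" using nonneg by simp_all
    then have "a \<le> m" "b \<le> m" using F G by linarith+
    then show "0 \<le> m - ?s" using amgm by linarith
    have "m * (2 * ?s) \<le> m * (a + b)" using amgm \<open>a \<le> m\<close> nonneg by (intro mult_left_mono) auto
    then show "(m - a) * (m - b) \<le> (m - ?s)\<^sup>2" using s2 by (simp add: power2_eq_square algebra_simps)
  qed
  finally show False using k by linarith
qed

section \<open>The spectrum of the Kneser graph\<close>

text \<open>The strict inequality makes the absolute values of the eigenvalues strictly decreasing; for
  \<open>n = 2 * k\<close> they all have absolute value 1.\<close>

locale kneser =
  fixes V :: "'a set" and n k :: nat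
  assumes finite_V: "finite V" and card_V: "card V = n" and k_small: "2 * k < n"
begin

abbreviation K :: "'a set set" where "K \<equiv> [V]\<^bsup>k\<^esup>"

definition adj :: "('a set \<Rightarrow> real) \<Rightarrow> 'a set \<Rightarrow> real" where
  "adj f S = (\<Sum>T | T \<in> K \<and> S \<inter> T = {}. f T)"

definition star_sum :: "('a set \<Rightarrow> real) \<Rightarrow> 'a set \<Rightarrow> real" where
  "star_sum f J = (\<Sum>S | S \<in> K \<and> J \<subseteq> S. f S)"

definition ip :: "('a set \<Rightarrow> real) \<Rightarrow> ('a set \<Rightarrow> real) \<Rightarrow> real" where
  "ip f g = (\<Sum>S\<in>K. f S * g S)"

text \<open>Equivalently, \<open>f\<close> is orthogonal to the indicators of the stars of all sets with fewer than \<open>j\<close> points.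
  In the Johnson scheme this space is the sum of the eigenspaces with index at least \<open>j\<close>.\<close>

definition orth_below :: "nat \<Rightarrow> ('a set \<Rightarrow> real) \<Rightarrow> bool" where
  "orth_below j f \<longleftrightarrow> (\<forall>J. J \<subseteq> V \<and> card J < j \<longrightarrow> star_sum f J = 0)"

definition eigval :: "nat \<Rightarrow> real" where
  "eigval j = (-1) ^ j * real ((n - k - j) choose (k - j))"

lemma finite_K: "finite K"
  using finite_V by (rule finite_imp_finite_nsets)

lemma K_D: "S \<in> K \<Longrightarrow> S \<subseteq> V \<and> finite S \<and> card S = k"
  by (simp add: nsets_def)

lemma adj_eq: "adj f S = (\<Sum>T\<in>K. of_bool (S \<inter> T = {}) * f T)"
  unfolding adj_def using finite_K by (auto intro!: sum.mono_neutral_cong_left)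

lemma star_sum_eq: "star_sum f J = (\<Sum>S\<in>K. of_bool (J \<subseteq> S) * f S)"
  unfolding star_sum_def using finite_K by (auto intro!: sum.mono_neutral_cong_left)

lemma ip_commute: "ip f g = ip g f"
  by (simp add: ip_def mult.commute)

lemma ip_add_right: "ip f (\<lambda>S. g S + h S) = ip f g + ip f h"
  by (simp add: ip_def sum.distrib algebra_simps)

lemma ip_add_left: "ip (\<lambda>S. g S + h S) f = ip g f + ip h f"
  by (simp add: ip_def sum.distrib algebra_simps)

lemma ip_cong: "(\<And>S. S \<in> K \<Longrightarrow> f S = f' S) \<Longrightarrow> (\<And>S. S \<in> K \<Longrightarrow> g S = g' S) \<Longrightarrow> ip f g = ip f' g'"
  unfolding ip_def by (intro sum.cong) auto

lemma ip_self_nonneg: "0 \<le> ip f f"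
  by (simp add: ip_def sum_nonneg)

lemma ip_adj_commute: "ip f (adj g) = ip (adj f) g"
proof -
  have "ip f (adj g) = (\<Sum>S\<in>K. \<Sum>T\<in>K. of_bool (S \<inter> T = {}) * f S * g T)"
    by (simp add: ip_def adj_eq sum_distrib_left mult_ac)
  also have "\<dots> = (\<Sum>T\<in>K. \<Sum>S\<in>K. of_bool (S \<inter> T = {}) * f S * g T)"
    by (rule sum.swap)
  also have "\<dots> = ip (adj f) g"
    by (simp add: ip_def adj_eq sum_distrib_left sum_distrib_right mult_ac Int_commute)
  finally show ?thesis .
qed

lemma orth_below_mono: "orth_below j f \<Longrightarrow> i \<le> j \<Longrightarrow> orth_below i f"
  by (auto simp: orth_below_def)

text \<open>The operator is applied at a set \<open>J\<close> that need not have \<open>k\<close> points, so \<open>adj f J\<close> is the sum of \<open>f\<close> over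
  the \<open>k\<close>-sets that miss \<open>J\<close>. Inclusion-exclusion expresses it by the star sums at the subsets of \<open>J\<close>, and
  those at proper subsets vanish.\<close>

lemma adj_eq_star_sum:
  assumes "orth_below (card J) f" "J \<subseteq> V"
  shows "adj f J = (-1) ^ card J * star_sum f J"
proof -
  have fJ: "finite J" using assms finite_V finite_subset by auto
  have "adj f J = (\<Sum>T\<in>K. (\<Sum>I\<in>Pow J. (-1) ^ card I * of_bool (I \<subseteq> T)) * f T)"
    using of_bool_disjoint_eq_alternating_sum[OF fJ] by (simp add: adj_eq Int_commute)
  also have "\<dots> = (\<Sum>I\<in>Pow J. (-1) ^ card I * star_sum f I)"
    unfolding star_sum_eq sum_distrib_left sum_distrib_right
    by (subst sum.swap) (simp add: mult_ac)
  also have "\<dots> = (\<Sum>I\<in>{J}. (-1) ^ card I * star_sum f I)"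
  proof (rule sum.mono_neutral_right)
    show "\<forall>I\<in>Pow J - {J}. (-1) ^ card I * star_sum f I = 0"
    proof
      fix I assume "I \<in> Pow J - {J}"
      then have "card I < card J" "I \<subseteq> V" using fJ assms psubset_card_mono by auto
      then show "(-1) ^ card I * star_sum f I = 0"
        using assms by (simp add: orth_below_def)
    qed
  qed (use fJ in auto)
  finally show ?thesis by simp
qed

text \<open>Exchanging the two sums, each \<open>k\<close>-set \<open>T\<close> disjoint from \<open>J\<close> is counted once for each \<open>k\<close>-set that
  contains \<open>J\<close> and misses \<open>T\<close>, which is a fixed number of times. The eigenvalues of the Kneser graph
  come out here.\<close>

lemma star_sum_adj:
  assumes "orth_below (card J) f" "J \<subseteq> V" "card J \<le> k"
  shows "star_sum (adj f) J = eigval (card J) * star_sum f J"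
proof -
  have count: "(\<Sum>S\<in>K. of_bool (J \<subseteq> S) * of_bool (S \<inter> T = {}))
      = of_bool (J \<inter> T = {}) * real ((n - k - card J) choose (k - card J))" if "T \<in> K" for T
  proof (cases "J \<inter> T = {}")
    case True
    have "(\<Sum>S\<in>K. of_bool (J \<subseteq> S) * of_bool (S \<inter> T = {}) :: real)
        = (\<Sum>S\<in>K. of_bool (S \<in> {S \<in> [V - T]\<^bsup>k\<^esup>. J \<subseteq> S}))"
      by (intro sum.cong) (auto simp: nsets_def of_bool_def)
    also have "\<dots> = real (card {S \<in> [V - T]\<^bsup>k\<^esup>. J \<subseteq> S})"
    proof -
      have "{S \<in> K. S \<in> {S \<in> [V - T]\<^bsup>k\<^esup>. J \<subseteq> S}} = {S \<in> [V - T]\<^bsup>k\<^esup>. J \<subseteq> S}"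
        by (auto simp: nsets_def)
      then show ?thesis
        using finite_K by (simp add: of_bool_def sum.inter_filter[symmetric])
    qed
    also have "card {S \<in> [V - T]\<^bsup>k\<^esup>. J \<subseteq> S} = (card (V - T) - card J) choose (k - card J)"
      using assms True finite_V by (intro card_nsets_superset) auto
    also have "card (V - T) = n - k"
      using K_D[OF that] by (simp add: card_Diff_subset card_V)
    finally show ?thesis using True by simp
  next
    case False
    then show ?thesis by (auto intro!: sum.neutral; blast)
  qed
  have "star_sum (adj f) J = (\<Sum>T\<in>K. (\<Sum>S\<in>K. of_bool (J \<subseteq> S) * of_bool (S \<inter> T = {})) * f T)"
    unfolding star_sum_eq adj_eq sum_distrib_left sum_distrib_right
    by (subst sum.swap) (simp add: mult_ac)
  also have "\<dots> = real ((n - k - card J) choose (k - card J)) * adj f J"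
    by (simp add: count adj_eq sum_distrib_left mult_ac)
  also have "\<dots> = eigval (card J) * star_sum f J"
    using adj_eq_star_sum[OF assms(1,2)] by (simp add: eigval_def)
  finally show ?thesis .
qed

lemma star_sum_diff: "star_sum (\<lambda>S. f S - g S) J = star_sum f J - star_sum g J"
  by (simp add: star_sum_def sum_subtractf)

lemma star_sum_scale: "star_sum (\<lambda>S. c * f S) J = c * star_sum f J"
  by (simp add: star_sum_def sum_distrib_left)

text \<open>The factors \<open>adj - eigval j\<close> therefore raise the level one step at a time, so that the product of all of
  them annihilates every function on the \<open>k\<close>-sets.\<close>

lemma orth_below_adj_diff:
  assumes "orth_below j f" "j \<le> k"
  shows "orth_below (Suc j) (\<lambda>S. adj f S - eigval j * f S)"
  unfolding orth_below_def
proof (intro allI impI)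
  fix J assume J: "J \<subseteq> V \<and> card J < Suc j"
  then have "star_sum (adj f) J = eigval (card J) * star_sum f J"
    using assms by (intro star_sum_adj) (auto intro: orth_below_mono)
  moreover have "card J = j \<or> star_sum f J = 0"
    using J assms by (auto simp: orth_below_def less_Suc_eq)
  ultimately show "star_sum (\<lambda>S. adj f S - eigval j * f S) J = 0"
    by (auto simp: star_sum_diff star_sum_scale)
qed

lemma star_sum_self:
  assumes "S \<in> K"
  shows "star_sum f S = f S"
proof -
  have "{T \<in> K. S \<subseteq> T} = {S}"
    using assms by (auto simp: nsets_def dest: card_subset_eq)
  then show ?thesis by (simp add: star_sum_def)
qed

lemma orth_below_Suc_k: "orth_below (Suc k) f \<Longrightarrow> S \<in> K \<Longrightarrow> f S = 0"
  using star_sum_self[of S f] by (auto simp: orth_below_def nsets_def)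

lemma abs_eigval: "\<bar>eigval j\<bar> = real ((n - k - j) choose (k - j))"
  by (simp add: eigval_def abs_mult)

lemma abs_eigval_Suc_less:
  assumes "j < k"
  shows "\<bar>eigval (Suc j)\<bar> < \<bar>eigval j\<bar>"
proof -
  obtain r where r: "k - j = Suc r" using assms by (cases "k - j") auto
  obtain N where N: "n - k - j = Suc N" using assms k_small by (cases "n - k - j") auto
  have e: "n - k - Suc j = N" "k - Suc j = r" using r N by auto
  have "N choose Suc r > 0" using r N assms k_small by (simp add: zero_less_binomial_iff)
  then show ?thesis unfolding abs_eigval e r N by simp
qed

lemma abs_eigval_less: "i < j \<Longrightarrow> j \<le> k \<Longrightarrow> \<bar>eigval j\<bar> < \<bar>eigval i\<bar>"
proof (induction j)
  case (Suc j)
  then show ?case using abs_eigval_Suc_less[of j] by (cases "i = j") fastforce+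
qed simp

lemma eigval_inj: "i \<noteq> j \<Longrightarrow> i \<le> k \<Longrightarrow> j \<le> k \<Longrightarrow> eigval i \<noteq> eigval j"
  using abs_eigval_less[of i j] abs_eigval_less[of j i] by (metis less_irrefl nat_neq_iff)

lemma adj_cong: "(\<And>T. T \<in> K \<Longrightarrow> f T = g T) \<Longrightarrow> adj f S = adj g S"
  by (auto simp: adj_def intro!: sum.cong)

lemma adj_sum: "adj (\<lambda>S. \<Sum>i\<in>I. F i S) S = (\<Sum>i\<in>I. adj (F i) S)"
  unfolding adj_def by (rule sum.swap)

lemma adj_diff: "adj (\<lambda>S. f S - g S) S = adj f S - adj g S"
  by (simp add: adj_def sum_subtractf)

lemma adj_scale: "adj (\<lambda>S. c * f S) S = c * adj f S"
  by (simp add: adj_def sum_distrib_left)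

text \<open>Downward induction on \<open>j\<close>: decompose \<open>g = adj f - eigval j * f\<close>, which lies one level higher, and divide its
  part with eigenvalue \<open>eigval i\<close> by \<open>eigval i - eigval j\<close>. What remains of \<open>f\<close> after subtracting these parts is an
  eigenvector with eigenvalue \<open>eigval j\<close>.\<close>

lemma orth_below_eigen_decomposition:
  assumes "orth_below j f" "j \<le> Suc k"
  shows "\<exists>F. (\<forall>i\<in>{j..k}. \<forall>S\<in>K. adj (F i) S = eigval i * F i S) \<and> (\<forall>S\<in>K. f S = (\<Sum>i=j..k. F i S))"
  using assms(2,1)
proof (induction arbitrary: f rule: inc_induct)
  case base
  then show ?case using orth_below_Suc_k by auto
next
  case (step j)
  define g where "g = (\<lambda>S. adj f S - eigval j * f S)"
  have jk: "j \<le> k" using step by simp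
  have "orth_below (Suc j) g" unfolding g_def using step.prems jk by (rule orth_below_adj_diff)
  from step.IH[OF this] obtain G where
    G: "\<And>i S. i \<in> {Suc j..k} \<Longrightarrow> S \<in> K \<Longrightarrow> adj (G i) S = eigval i * G i S"
    and g: "\<And>S. S \<in> K \<Longrightarrow> g S = (\<Sum>i=Suc j..k. G i S)" by blast
  define H where "H i S = 1 / (eigval i - eigval j) * G i S" for i S
  define F where "F = H(j := \<lambda>S. f S - (\<Sum>i=Suc j..k. H i S))"
  have H: "adj (H i) S = eigval i * H i S" if "i \<in> {Suc j..k}" "S \<in> K" for i S
    unfolding H_def adj_scale G[OF that] by simp
  have GH: "G i S = (eigval i - eigval j) * H i S" if "i \<in> {Suc j..k}" for i S
    using eigval_inj[of i j] that jk by (simp add: H_def)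
  have split: "(\<Sum>i=j..k. F i S) = F j S + (\<Sum>i=Suc j..k. H i S)" for S
    using jk by (simp add: sum.atLeast_Suc_atMost F_def)
  have Fj: "adj (F j) S = eigval j * F j S" if "S \<in> K" for S
  proof -
    have "adj (F j) S = adj f S - (\<Sum>i=Suc j..k. eigval i * H i S)"
      using that by (simp add: F_def adj_diff adj_sum H)
    also have "adj f S = eigval j * f S + g S" by (simp add: g_def)
    also have "g S = (\<Sum>i=Suc j..k. eigval i * H i S) - (\<Sum>i=Suc j..k. eigval j * H i S)"
      using that by (simp add: g GH algebra_simps sum_subtractf)
    finally show ?thesis by (simp add: F_def algebra_simps sum_distrib_left)
  qed
  show ?case
  proof (intro exI[of _ F] conjI ballI)
    fix i S assume i: "i \<in> {j..k}" and S: "S \<in> K"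
    show "adj (F i) S = eigval i * F i S"
    proof (cases "i = j")
      case True
      then show ?thesis using Fj S by simp
    next
      case False
      then have "F i = H i" by (simp add: F_def)
      then show ?thesis using H i S False by simp
    qed
  next
    fix S assume "S \<in> K"
    show "f S = (\<Sum>i=j..k. F i S)" unfolding split by (simp add: F_def)
  qed
qed

lemma eigen_orthogonal:
  assumes "\<And>S. S \<in> K \<Longrightarrow> adj f S = a * f S" "\<And>S. S \<in> K \<Longrightarrow> adj g S = b * g S" "a \<noteq> b"
  shows "ip f g = 0"
proof -
  have "a * ip f g = ip (adj f) g"
    using assms(1) by (simp add: ip_def sum_distrib_left mult_ac)
  also have "\<dots> = ip f (adj g)" by (rule ip_adj_commute[symmetric])
  also have "\<dots> = b * ip f g"
    using assms(2) by (simp add: ip_def sum_distrib_left mult_ac)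
  finally show ?thesis using assms(3) by simp
qed

lemma ip_sum_sum: "ip (\<lambda>S. \<Sum>i\<in>I. F i S) (\<lambda>S. \<Sum>j\<in>I'. G j S) = (\<Sum>i\<in>I. \<Sum>j\<in>I'. ip (F i) (G j))"
proof -
  have "ip (\<lambda>S. \<Sum>i\<in>I. F i S) (\<lambda>S. \<Sum>j\<in>I'. G j S) = (\<Sum>S\<in>K. \<Sum>i\<in>I. \<Sum>j\<in>I'. F i S * G j S)"
    by (simp add: ip_def sum_product)
  also have "\<dots> = (\<Sum>i\<in>I. \<Sum>S\<in>K. \<Sum>j\<in>I'. F i S * G j S)"
    by (rule sum.swap)
  also have "\<dots> = (\<Sum>i\<in>I. \<Sum>j\<in>I'. \<Sum>S\<in>K. F i S * G j S)"
    by (rule sum.cong[OF refl], rule sum.swap)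
  finally show ?thesis by (simp add: ip_def)
qed

lemma ip_scale_scale: "ip (\<lambda>S. a * f S) (\<lambda>S. b * g S) = a * b * ip f g"
  by (simp add: ip_def sum_distrib_left mult_ac)

text \<open>The eigenvectors in the decomposition are orthogonal, and \<open>eigval j\<close> has the largest absolute value among the
  eigenvalues that occur.\<close>

lemma adj_norm_le:
  assumes "orth_below j f" "j \<le> k"
  shows "ip (adj f) (adj f) \<le> (eigval j)\<^sup>2 * ip f f"
proof -
  obtain F where F: "\<And>i S. i \<in> {j..k} \<Longrightarrow> S \<in> K \<Longrightarrow> adj (F i) S = eigval i * F i S"
    and f: "\<And>S. S \<in> K \<Longrightarrow> f S = (\<Sum>i=j..k. F i S)"
    using orth_below_eigen_decomposition[OF assms(1)] assms(2) by (metis le_SucI)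
  have orth: "ip (F i) (F l) = 0" if "i \<in> {j..k}" "l \<in> {j..k}" "i \<noteq> l" for i l
    using F[OF that(1)] F[OF that(2)] eigval_inj[of i l] that by (intro eigen_orthogonal) auto
  have pyth: "ip (\<lambda>S. \<Sum>i=j..k. a i * F i S) (\<lambda>S. \<Sum>i=j..k. a i * F i S)
      = (\<Sum>i=j..k. (a i)\<^sup>2 * ip (F i) (F i))" for a
  proof -
    have "ip (\<lambda>S. \<Sum>i=j..k. a i * F i S) (\<lambda>S. \<Sum>i=j..k. a i * F i S)
        = (\<Sum>i=j..k. \<Sum>l=j..k. a i * a l * ip (F i) (F l))"
      by (simp add: ip_sum_sum ip_scale_scale)
    also have "\<dots> = (\<Sum>i=j..k. \<Sum>l\<in>{i}. a i * a l * ip (F i) (F l))"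
      by (intro sum.cong refl sum.mono_neutral_right) (auto simp: orth)
    finally show ?thesis by (simp add: power2_eq_square)
  qed
  have Af: "adj f S = (\<Sum>i=j..k. eigval i * F i S)" if "S \<in> K" for S
  proof -
    have "adj f S = adj (\<lambda>S. \<Sum>i=j..k. F i S) S" by (rule adj_cong) (rule f)
    then show ?thesis using F that by (simp add: adj_sum)
  qed
  have "ip (adj f) (adj f) = (\<Sum>i=j..k. (eigval i)\<^sup>2 * ip (F i) (F i))"
    unfolding pyth[symmetric] by (rule ip_cong) (simp_all add: Af)
  also have "\<dots> \<le> (\<Sum>i=j..k. (eigval j)\<^sup>2 * ip (F i) (F i))"
  proof (intro sum_mono mult_right_mono ip_self_nonneg)
    fix i assume "i \<in> {j..k}"
    then have "\<bar>eigval i\<bar> \<le> \<bar>eigval j\<bar>" using abs_eigval_less[of j i] by (cases "i = j") auto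
    then show "(eigval i)\<^sup>2 \<le> (eigval j)\<^sup>2" by (simp add: abs_le_square_iff)
  qed
  also have "\<dots> = (eigval j)\<^sup>2 * (\<Sum>i=j..k. 1\<^sup>2 * ip (F i) (F i))"
    by (simp add: sum_distrib_left)
  also have "(\<Sum>i=j..k. 1\<^sup>2 * ip (F i) (F i)) = ip f f"
    unfolding pyth[symmetric] by (rule ip_cong) (simp_all add: f)
  finally show ?thesis .
qed

lemma ip_adj_le:
  assumes "orth_below j g" "j \<le> k"
  shows "(ip f (adj g))\<^sup>2 \<le> (eigval j)\<^sup>2 * ip f f * ip g g"
proof -
  have "(ip f (adj g))\<^sup>2 \<le> ip f f * ip (adj g) (adj g)"
    unfolding ip_def using Cauchy_Schwarz_ineq_sum[of f "adj g" K] by (simp add: power2_eq_square)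
  also have "\<dots> \<le> ip f f * ((eigval j)\<^sup>2 * ip g g)"
    using adj_norm_le[OF assms] by (intro mult_left_mono ip_self_nonneg)
  finally show ?thesis by (simp add: mult_ac)
qed

section \<open>Splitting off the average and the degrees\<close>

text \<open>For a family \<open>\<F>\<close> with indicator \<open>f\<close>, the star sums of \<open>f\<close> at \<open>{}\<close> and at \<open>{i}\<close> are the number of members
  and the degree of \<open>i\<close>. So the projection of \<open>f\<close> to the affine functions of the points of a set is
  determined by the degrees.\<close>

definition lin :: "('a \<Rightarrow> real) \<Rightarrow> 'a set \<Rightarrow> real" where
  "lin c S = (\<Sum>i\<in>S. c i)"

definition mean :: "('a set \<Rightarrow> real) \<Rightarrow> real" where
  "mean f = star_sum f {} / real (n choose k)"

definition degree_dev :: "('a set \<Rightarrow> real) \<Rightarrow> 'a \<Rightarrow> real" where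
  "degree_dev f i = star_sum f {i} - real k * star_sum f {} / real n"

text \<open>The divisor is the factor by which passing from weights with sum zero to star sums at points multiplies
  them, see \<open>star_sum_lin_singleton\<close>; it gives the affine part the same star
  sums as \<open>f\<close> at sets with at most one point.\<close>

definition affine_part :: "('a set \<Rightarrow> real) \<Rightarrow> 'a set \<Rightarrow> real" where
  "affine_part f S = mean f + lin (\<lambda>i. degree_dev f i / real ((n - 2) choose (k - 1))) S"

definition residual :: "('a set \<Rightarrow> real) \<Rightarrow> 'a set \<Rightarrow> real" where
  "residual f S = f S - affine_part f S"

lemma star_sum_add: "star_sum (\<lambda>S. f S + g S) J = star_sum f J + star_sum g J"
  by (simp add: star_sum_def sum.distrib)

lemma star_sum_const:
  assumes "J \<subseteq> V" "card J \<le> k"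
  shows "star_sum (\<lambda>_. m) J = m * real ((n - card J) choose (k - card J))"
  using card_nsets_superset[OF finite_V assms] by (simp add: star_sum_def card_V)

lemma ip_const: "ip (\<lambda>_. m) u = m * star_sum u {}"
  by (simp add: ip_def star_sum_eq sum_distrib_left)

lemma lin_eq: "S \<in> K \<Longrightarrow> lin c S = (\<Sum>i\<in>V. c i * of_bool ({i} \<subseteq> S))"
  unfolding lin_def using finite_V K_D by (auto intro!: sum.mono_neutral_cong_left)

lemma ip_lin: "ip (lin c) u = (\<Sum>i\<in>V. c i * star_sum u {i})"
proof -
  have "ip (lin c) u = (\<Sum>S\<in>K. \<Sum>i\<in>V. c i * of_bool ({i} \<subseteq> S) * u S)"
    unfolding ip_def by (intro sum.cong refl) (simp add: lin_eq sum_distrib_right)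
  also have "\<dots> = (\<Sum>i\<in>V. c i * star_sum u {i})"
    unfolding star_sum_eq by (subst sum.swap) (simp add: sum_distrib_left mult_ac)
  finally show ?thesis .
qed

lemma sum_star_sum_singleton: "(\<Sum>i\<in>V. star_sum f {i}) = real k * star_sum f {}"
proof -
  have "(\<Sum>i\<in>V. star_sum f {i}) = ip (lin (\<lambda>_. 1)) f" by (simp add: ip_lin)
  also have "\<dots> = ip (\<lambda>_. real k) f" by (rule ip_cong) (auto simp: lin_def nsets_def)
  finally show ?thesis by (simp add: ip_const)
qed

lemma sum_degree_dev: "(\<Sum>i\<in>V. degree_dev f i) = 0"
  using k_small by (simp add: degree_dev_def sum_subtractf sum_star_sum_singleton card_V)

lemma ip_affine_part:
  "ip (affine_part f) u = mean f * star_sum u {}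
     + (\<Sum>i\<in>V. degree_dev f i * star_sum u {i}) / real ((n - 2) choose (k - 1))"
proof -
  have "affine_part f = (\<lambda>S. mean f + lin (\<lambda>i. degree_dev f i / real ((n - 2) choose (k - 1))) S)"
    by (simp add: affine_part_def fun_eq_iff)
  then show ?thesis by (simp add: ip_add_left ip_const ip_lin sum_divide_distrib)
qed

text \<open>A point \<open>i\<close> other than \<open>x\<close> contributes \<open>(n - 2) choose (k - 2)\<close> times its weight, and \<open>x\<close> itself
  \<open>(n - 1) choose (k - 1)\<close> times. As the weights sum to zero, only the difference of these two numbers
  survives, by Pascal's rule.\<close>

lemma star_sum_lin_singleton:
  assumes "2 \<le> k" "x \<in> V" "(\<Sum>i\<in>V. c i) = 0"
  shows "star_sum (lin c) {x} = real ((n - 2) choose (k - 1)) * c x"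
proof -
  have pascal: "(n - 1) choose (k - 1) = ((n - 2) choose (k - 2)) + ((n - 2) choose (k - 1))"
  proof -
    obtain q N where "k = Suc (Suc q)" "n = Suc (Suc N)"
      using assms(1) k_small that[of "k - 2" "n - 2"] by linarith
    then show ?thesis by simp
  qed
  have "star_sum (lin c) {x} = (\<Sum>S\<in>K. \<Sum>i\<in>V. c i * of_bool ({x, i} \<subseteq> S))"
    unfolding star_sum_eq by (intro sum.cong refl) (auto simp: lin_eq)
  also have "\<dots> = (\<Sum>i\<in>V. c i * star_sum (\<lambda>_. 1) {x, i})"
    unfolding star_sum_eq by (subst sum.swap) (simp add: sum_distrib_left)
  also have "\<dots> = (\<Sum>i\<in>V. c i * real ((n - 2) choose (k - 2))
      + (if i = x then c i * real ((n - 2) choose (k - 1)) else 0))"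
  proof (intro sum.cong refl)
    fix i assume i: "i \<in> V"
    show "c i * star_sum (\<lambda>_. 1) {x, i} = c i * real ((n - 2) choose (k - 2))
      + (if i = x then c i * real ((n - 2) choose (k - 1)) else 0)"
    proof (cases "i = x")
      case True
      then show ?thesis using i assms pascal by (simp add: star_sum_const distrib_left)
    next
      case False
      then show ?thesis using i assms by (simp add: star_sum_const card_insert_if numeral_2_eq_2)
    qed
  qed
  also have "\<dots> = real ((n - 2) choose (k - 1)) * c x"
    using assms finite_V by (simp add: sum.distrib sum.delta sum_distrib_right[symmetric])
  finally show ?thesis .
qed

lemma binomial_mean: "k \<ge> 1 \<Longrightarrow> real ((n - 1) choose (k - 1)) / real (n choose k) = real k / real n"
proof -
  assume "k \<ge> 1"
  then have "k * (n choose k) = n * ((n - 1) choose (k - 1))"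
    by (simp add: times_binomial_minus1_eq)
  then have "real k * real (n choose k) = real n * real ((n - 1) choose (k - 1))"
    by (metis of_nat_mult)
  moreover have "n choose k > 0" "n > 0" using k_small by auto
  ultimately show ?thesis by (simp add: field_simps)
qed

lemma mean_times:
  assumes "k \<ge> 1"
  shows "mean f * real ((n - 1) choose (k - 1)) = real k * star_sum f {} / real n"
proof -
  have "mean f * real ((n - 1) choose (k - 1))
      = star_sum f {} * (real ((n - 1) choose (k - 1)) / real (n choose k))"
    by (simp add: mean_def)
  also have "\<dots> = star_sum f {} * (real k / real n)"
    by (simp only: binomial_mean[OF assms])
  finally show ?thesis by simp
qed

lemma orth_below_residual:
  assumes "2 \<le> k"
  shows "orth_below 2 (residual f)"
  unfolding orth_below_def
proof (intro allI impI)
  fix J assume J: "J \<subseteq> V \<and> card J < 2"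
  let ?M = "real ((n - 2) choose (k - 1))"
  have M: "?M > 0" using k_small assms by simp
  have affine_part: "star_sum (affine_part f) J = star_sum (\<lambda>_. mean f) J + star_sum (lin (\<lambda>i. degree_dev f i / ?M)) J" for J
    unfolding star_sum_add[symmetric] affine_part_def ..
  have sum0: "(\<Sum>i\<in>V. degree_dev f i / ?M) = 0" by (simp add: sum_divide_distrib[symmetric] sum_degree_dev)
  have N: "n choose k > 0" using k_small by simp
  have "finite J" using J finite_V finite_subset by blast
  then consider "J = {}" | x where "J = {x}" "x \<in> V"
    using J by (metis One_nat_def card_0_eq card_1_singletonE insert_subset less_2_cases)
  then have "star_sum (affine_part f) J = star_sum f J"
  proof cases
    case 1
    have "star_sum (lin (\<lambda>i. degree_dev f i / ?M)) {} = ip (lin (\<lambda>i. degree_dev f i / ?M)) (\<lambda>_. 1)"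
      by (simp add: ip_commute[of _ "\<lambda>_. 1"] ip_const)
    also have "\<dots> = (\<Sum>i\<in>V. degree_dev f i / ?M * real ((n - 1) choose (k - 1)))"
      unfolding ip_lin using assms by (intro sum.cong refl) (simp add: star_sum_const)
    also have "\<dots> = 0" unfolding sum_distrib_right[symmetric] sum0 by simp
    finally show ?thesis using 1 N by (simp add: affine_part star_sum_const mean_def)
  next
    case 2
    have "star_sum (lin (\<lambda>i. degree_dev f i / ?M)) {x} = degree_dev f x"
      using star_sum_lin_singleton[OF assms 2(2) sum0] M by simp
    moreover have "star_sum (\<lambda>_. mean f) {x} = real k * star_sum f {} / real n"
      using 2 assms mean_times[of f] by (simp add: star_sum_const)
    ultimately show ?thesis using 2 by (simp add: affine_part degree_dev_def)
  qed
  then show "star_sum (residual f) J = 0"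
    using star_sum_diff[of f "affine_part f" J] by (simp add: residual_def[abs_def])
qed

lemma adj_const: "S \<in> K \<Longrightarrow> adj (\<lambda>_. m) S = m * eigval 0"
proof -
  assume S: "S \<in> K"
  have "{T \<in> K. S \<inter> T = {}} = [V - S]\<^bsup>k\<^esup>" by (auto simp: nsets_def)
  then show ?thesis using K_D[OF S] by (simp add: adj_def eigval_def card_Diff_subset card_V)
qed

text \<open>Only the star sums of \<open>adj u\<close> at \<open>{}\<close> and at points matter. At points, \<open>star_sum_adj\<close> requires the mean to be
  removed first; the mean shifts all these star sums equally, and the shifts cancel because the deviations of the
  degrees sum to zero.\<close>

lemma ip_affine_part_adj:
  assumes "1 \<le> k"
  shows "ip (affine_part f) (adj u) = eigval 0 * mean f * star_sum u {}
     + eigval 1 * (\<Sum>i\<in>V. degree_dev f i * degree_dev u i) / real ((n - 2) choose (k - 1))"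
proof -
  let ?u = "\<lambda>S. u S - mean u"
  have su: "star_sum ?u {i} = degree_dev u i" if "i \<in> V" for i
    using that assms mean_times[OF assms, of u] star_sum_diff[of u "\<lambda>_. mean u" "{i}"]
    by (simp add: star_sum_const degree_dev_def)
  have lev: "orth_below 1 ?u"
    unfolding orth_below_def
  proof (intro allI impI)
    fix J assume "J \<subseteq> V \<and> card J < 1"
    then have "J = {}" using finite_V finite_subset by fastforce
    then show "star_sum ?u J = 0"
      using k_small star_sum_diff[of u "\<lambda>_. mean u" "{}"] by (simp add: star_sum_const mean_def)
  qed
  have s1: "star_sum (adj u) {i} = eigval 1 * degree_dev u i + mean u * eigval 0 * real ((n - 1) choose (k - 1))"
    if "i \<in> V" for i
  proof -
    have "star_sum (adj u) {i} = star_sum (\<lambda>S. adj ?u S + mean u * eigval 0) {i}"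
      unfolding star_sum_def by (intro sum.cong refl) (simp add: adj_diff adj_const)
    also have "\<dots> = star_sum (adj ?u) {i} + mean u * eigval 0 * real ((n - 1) choose (k - 1))"
      using that assms by (simp add: star_sum_add star_sum_const)
    also have "star_sum (adj ?u) {i} = eigval 1 * star_sum ?u {i}"
      using star_sum_adj[of "{i}" ?u] lev that assms by simp
    finally show ?thesis using that by (simp add: su)
  qed
  have "(\<Sum>i\<in>V. degree_dev f i * star_sum (adj u) {i})
      = (\<Sum>i\<in>V. eigval 1 * (degree_dev f i * degree_dev u i) + degree_dev f i * (mean u * eigval 0 * real ((n - 1) choose (k - 1))))"
    by (intro sum.cong refl) (simp add: s1 algebra_simps)
  also have "\<dots> = eigval 1 * (\<Sum>i\<in>V. degree_dev f i * degree_dev u i)"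
    by (simp add: sum.distrib sum_distrib_left[symmetric] sum_distrib_right[symmetric] sum_degree_dev)
  finally have "(\<Sum>i\<in>V. degree_dev f i * star_sum (adj u) {i}) = eigval 1 * (\<Sum>i\<in>V. degree_dev f i * degree_dev u i)" .
  moreover have "star_sum (adj u) {} = eigval 0 * star_sum u {}"
    using star_sum_adj[of "{}" u] by (simp add: orth_below_def)
  ultimately show ?thesis by (simp add: ip_affine_part)
qed

lemma orth_below_2_D: "orth_below 2 u \<Longrightarrow> star_sum u {} = 0" "orth_below 2 u \<Longrightarrow> i \<in> V \<Longrightarrow> star_sum u {i} = 0"
  by (auto simp: orth_below_def)

lemma affine_part_add_residual: "f = (\<lambda>S. affine_part f S + residual f S)"
  by (simp add: residual_def fun_eq_iff)

lemma adj_add: "adj (\<lambda>S. f S + g S) = (\<lambda>S. adj f S + adj g S)"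
  by (simp add: adj_def sum.distrib fun_eq_iff)

text \<open>There is no mixed term: since \<open>adj\<close> is symmetric, it can be moved to the residual, whose mean and degree
  deviations are zero.\<close>

lemma ip_adj_decomposition:
  assumes "2 \<le> k"
  shows "ip f (adj g) = eigval 0 * mean f * star_sum g {}
     + eigval 1 * (\<Sum>i\<in>V. degree_dev f i * degree_dev g i) / real ((n - 2) choose (k - 1)) + ip (residual f) (adj (residual g))"
proof -
  have "ip (residual f) (adj (affine_part g)) = ip (affine_part g) (adj (residual f))"
    by (metis ip_adj_commute ip_commute)
  also have "\<dots> = 0"
    using orth_below_2_D[OF orth_below_residual[OF assms, of f]] assms by (simp add: ip_affine_part_adj degree_dev_def)
  finally have "ip (residual f) (adj g) = ip (residual f) (adj (residual g))"
    using adj_add[of "affine_part g" "residual g"] by (simp add: affine_part_add_residual[symmetric] ip_add_right)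
  moreover have "ip f (adj g) = ip (affine_part f) (adj g) + ip (residual f) (adj g)"
    using ip_add_left[of "affine_part f" "residual f" "adj g"] by (simp add: affine_part_add_residual[symmetric])
  ultimately show ?thesis using assms by (simp add: ip_affine_part_adj)
qed

lemma ip_self_decomposition:
  assumes "2 \<le> k"
  shows "ip f f = mean f * star_sum f {} + (\<Sum>i\<in>V. (degree_dev f i)\<^sup>2) / real ((n - 2) choose (k - 1))
    + ip (residual f) (residual f)"
proof -
  have orth: "ip (affine_part f) (residual f) = 0"
    using orth_below_2_D[OF orth_below_residual[OF assms, of f]] by (simp add: ip_affine_part)
  have "ip f f = ip (affine_part f) f + ip (residual f) f"
    using ip_add_left[of "affine_part f" "residual f" f] by (simp add: affine_part_add_residual[symmetric])
  moreover have "ip (residual f) f = ip (residual f) (residual f)"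
    using ip_add_right[of "residual f" "affine_part f" "residual f"] orth ip_commute[of "residual f" "affine_part f"]
    by (simp add: affine_part_add_residual[symmetric])
  moreover have "(\<Sum>i\<in>V. degree_dev f i * star_sum f {i}) = (\<Sum>i\<in>V. (degree_dev f i)\<^sup>2)"
  proof -
    have "(\<Sum>i\<in>V. degree_dev f i * star_sum f {i})
        = (\<Sum>i\<in>V. (degree_dev f i)\<^sup>2 + degree_dev f i * (real k * star_sum f {} / real n))"
      by (intro sum.cong refl) (simp add: degree_dev_def power2_eq_square algebra_simps)
    then show ?thesis
      unfolding sum.distrib sum_distrib_right[symmetric] sum_degree_dev by simp
  qed
  ultimately show ?thesis by (simp add: ip_affine_part)
qed

section \<open>Cross-intersecting families\<close>

text \<open>These turn the ratios of the numbers of sets and of the eigenvalues in the final estimate into rational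
  functions of \<open>n\<close> and \<open>k\<close>.\<close>

lemma binomial_ratios:
  assumes "2 \<le> k"
  shows "real ((n - 2) choose (k - 1)) * (real n * (real n - 1)) = real (n choose k) * (real k * (real n - real k))"
    and "(real n - real k) * real ((n - 2) choose (k - 2)) = (real k - 1) * real ((n - 2) choose (k - 1))"
    and "eigval 1 * (real n - real k) = - (eigval 0 * real k)"
    and "eigval 2 * ((real n - real k) * (real n - real k - 1)) = eigval 0 * (real k * (real k - 1))"
proof -
  have down: "real r * real (N choose r) = real N * real ((N - 1) choose (r - 1))" if "1 \<le> r" for N r
    using that times_binomial_minus1_eq[of r N] by (metis of_nat_mult less_eq_Suc_le One_nat_def)
  have keep: "(real N - real r) * real (N choose r) = real N * real ((N - 1) choose r)" if "r \<le> N" for N r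
    using that binomial_absorb_comp[of N r] by (metis of_nat_mult of_nat_diff)
  have sub: "real (n - 1) = real n - 1" "real (k - 1) = real k - 1" "real (n - k) = real n - real k"
    "n - 1 - 1 = n - 2" "k - 1 - 1 = k - 2" "real (n - k - 1) = real n - real k - 1" "n - k - 1 - 1 = n - k - 2"
    using assms k_small by auto
  have 1: "real k * real (n choose k) = real n * real ((n - 1) choose (k - 1))"
    using down[of k n] assms by simp
  have 2: "(real n - real k) * real ((n - 1) choose (k - 1)) = (real n - 1) * real ((n - 2) choose (k - 1))"
    using keep[of "k - 1" "n - 1"] assms k_small unfolding sub by simp
  show "real ((n - 2) choose (k - 1)) * (real n * (real n - 1)) = real (n choose k) * (real k * (real n - real k))"
    using 1 2 by algebra
  have 3: "(real k - 1) * real ((n - 1) choose (k - 1)) = (real n - 1) * real ((n - 2) choose (k - 2))"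
    using down[of "k - 1" "n - 1"] assms unfolding sub by simp
  have "(real n - 1) * ((real n - real k) * real ((n - 2) choose (k - 2)))
      = (real n - 1) * ((real k - 1) * real ((n - 2) choose (k - 1)))"
    using 2 3 by algebra
  then show "(real n - real k) * real ((n - 2) choose (k - 2)) = (real k - 1) * real ((n - 2) choose (k - 1))"
    using assms k_small by simp
  have 4: "real k * real ((n - k) choose k) = (real n - real k) * real ((n - k - 1) choose (k - 1))"
    using down[of k "n - k"] assms unfolding sub by simp
  have 5: "(real k - 1) * real ((n - k - 1) choose (k - 1)) = (real n - real k - 1) * real ((n - k - 2) choose (k - 2))"
    using down[of "k - 1" "n - k - 1"] assms unfolding sub by simp
  show "eigval 1 * (real n - real k) = - (eigval 0 * real k)"
    using 4 by (simp add: eigval_def mult_ac)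
  have "real ((n - k - 2) choose (k - 2)) * ((real n - real k) * (real n - real k - 1))
      = real ((n - k) choose k) * (real k * (real k - 1))"
    using 4 5 by algebra
  then show "eigval 2 * ((real n - real k) * (real n - real k - 1)) = eigval 0 * (real k * (real k - 1))"
    by (simp add: eigval_def)
qed

definition ind :: "'a set set \<Rightarrow> 'a set \<Rightarrow> real" where
  "ind \<F> S = of_bool (S \<in> \<F>)"

context
  fixes \<F> assumes \<F>: "\<F> \<subseteq> K"
begin

lemma star_sum_ind: "star_sum (ind \<F>) J = real (card {S \<in> \<F>. J \<subseteq> S})"
proof -
  have "star_sum (ind \<F>) J = (\<Sum>S | S \<in> \<F> \<and> J \<subseteq> S. 1)"
    unfolding star_sum_def ind_def using \<F> finite_K
    by (intro sum.mono_neutral_cong_right) auto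
  then show ?thesis by simp
qed

lemma star_sum_ind_empty: "star_sum (ind \<F>) {} = real (card \<F>)"
  by (simp add: star_sum_ind)

lemma star_sum_ind_singleton: "star_sum (ind \<F>) {i} = real (vertex_degree \<F> i)"
  by (simp add: star_sum_ind vertex_degree_def)

lemma ip_ind_self: "ip (ind \<F>) (ind \<F>) = real (card \<F>)"
proof -
  have "ip (ind \<F>) (ind \<F>) = star_sum (ind \<F>) {}"
    unfolding ip_def star_sum_def by (intro sum.cong) (auto simp: ind_def)
  then show ?thesis by (simp add: star_sum_ind_empty)
qed

lemma vertex_degree_le_card: "vertex_degree \<F> i \<le> card \<F>"
  unfolding vertex_degree_def using finite_subset[OF \<F> finite_K] by (intro card_mono) auto

text \<open>\<open>F1\<close> and \<open>F2\<close> are the squared norms of the degree part and of the residual, relative to that of the mean.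
  Their sum is \<open>N / card \<F> - 1\<close>, so that the assertion is \<open>F1 + a * (N / card \<F>) \<le> n - 1\<close>, which is the bound
  on the variance of the degrees. By the second of the
  \<open>binomial_ratios\<close>, the scaling of \<open>a\<close> makes \<open>\<delta> = (n - 2) choose (k - 2)\<close> correspond to \<open>a = k - 1\<close>.\<close>

lemma weight_bound:
  fixes \<delta> :: real
  assumes "2 \<le> k" "\<And>i. i \<in> V \<Longrightarrow> \<delta> \<le> vertex_degree \<F> i" "0 < card \<F>"
  defines "M \<equiv> real ((n - 2) choose (k - 1))" and "N \<equiv> real (n choose k)"
  defines "a \<equiv> \<delta> * (real n - real k) / M"
    and "F1 \<equiv> N * (\<Sum>i\<in>V. (degree_dev (ind \<F>) i)\<^sup>2) / (M * (real (card \<F>))\<^sup>2)"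
    and "F2 \<equiv> N * ip (residual (ind \<F>)) (residual (ind \<F>)) / (real (card \<F>))\<^sup>2"
  shows "(1 + a) * F1 + a * F2 \<le> real n - 1 - a"
proof -
  let ?b = "real (card \<F>)" and ?s = "\<Sum>i\<in>V. (degree_dev (ind \<F>) i)\<^sup>2"
  have pos: "M > 0" "N > 0" "?b > 0" "real n > 0" using assms k_small by auto
  have s: "?s \<le> ?b * (real n - real k) * (real k * ?b - real n * \<delta>) / real n"
    unfolding degree_dev_def star_sum_ind_empty star_sum_ind_singleton
  proof (rule sum_square_deviation_le)
    show "(\<Sum>i\<in>V. real (vertex_degree \<F> i)) = real k * ?b"
      using sum_star_sum_singleton[of "ind \<F>"] by (simp add: star_sum_ind_empty star_sum_ind_singleton)
  qed (use assms k_small vertex_degree_le_card card_V in auto)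
  have "?b = ?b\<^sup>2 / N + ?s / M + ip (residual (ind \<F>)) (residual (ind \<F>))"
    using ip_self_decomposition[OF assms(1), of "ind \<F>"]
    by (simp add: ip_ind_self star_sum_ind_empty mean_def M_def N_def power2_eq_square)
  then have "N * ?b / ?b\<^sup>2 = 1 + F1 + F2"
    unfolding F1_def F2_def using pos by (simp add: field_simps)
  then have sum: "F1 + F2 = N / ?b - 1" using pos by (simp add: power2_eq_square)
  have "N * ?s / (M * ?b\<^sup>2) \<le> N * (?b * (real n - real k) * (real k * ?b - real n * \<delta>) / real n) / (M * ?b\<^sup>2)"
    using s pos by (intro divide_right_mono mult_left_mono) auto
  also have "\<dots> = (N * (real k * (real n - real k))) / (M * real n) - a * (N / ?b)"
    using pos by (simp add: a_def field_simps power2_eq_square)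
  also have "N * (real k * (real n - real k)) = M * (real n * (real n - 1))"
    using binomial_ratios(1)[OF assms(1)] by (simp add: M_def N_def)
  also have "\<dots> / (M * real n) = real n - 1" using pos by simp
  finally have "F1 + a * (N / ?b) \<le> real n - 1" by (simp add: F1_def)
  moreover have "(1 + a) * F1 + a * F2 = F1 + a * (N / ?b) - a"
    using sum by algebra
  ultimately show ?thesis by linarith
qed

end

lemma ip_adj_cross_intersecting:
  assumes "cross_intersecting \<F> \<G>"
  shows "ip (ind \<F>) (adj (ind \<G>)) = 0"
  using assms unfolding ip_def adj_def ind_def cross_intersecting_def
  by (auto intro!: sum.neutral)

text \<open>The three terms of \<open>0 = \<langle>f, A g\<rangle>\<close> are estimated by Cauchy-Schwarz and the norm bound at level 2. After scaling they
  satisfy the hypotheses of \<open>two_level_optimisation\<close> with \<open>\<kappa> = k - 1\<close> and \<open>m = n - 1\<close>.\<close>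

lemma degree_product_le:
  fixes \<delta> \<epsilon> :: real
  assumes "2 \<le> k" "\<F> \<subseteq> K" "\<G> \<subseteq> K" "cross_intersecting \<F> \<G>" "0 < \<delta>" "0 < \<epsilon>"
    and \<delta>: "\<And>i. i \<in> V \<Longrightarrow> \<delta> \<le> vertex_degree \<F> i" and \<epsilon>: "\<And>i. i \<in> V \<Longrightarrow> \<epsilon> \<le> vertex_degree \<G> i"
  shows "\<delta> * \<epsilon> \<le> (real ((n - 2) choose (k - 2)))\<^sup>2"
proof -
  define M N p where "M = real ((n - 2) choose (k - 1))" and "N = real (n choose k)" and "p = real n - real k"
  define b c where "b = real (card \<F>)" and "c = real (card \<G>)"
  define s t \<sigma> where "s = (\<Sum>i\<in>V. (degree_dev (ind \<F>) i)\<^sup>2)" and "t = (\<Sum>i\<in>V. (degree_dev (ind \<G>) i)\<^sup>2)"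
    and "\<sigma> = (\<Sum>i\<in>V. degree_dev (ind \<F>) i * degree_dev (ind \<G>) i)"
  define x y r where "x = ip (residual (ind \<F>)) (residual (ind \<F>))" and "y = ip (residual (ind \<G>)) (residual (ind \<G>))"
    and "r = ip (residual (ind \<F>)) (adj (residual (ind \<G>)))"
  define F1 F2 G1 G2 where "F1 = N * s / (M * b\<^sup>2)" and "F2 = N * x / b\<^sup>2"
    and "G1 = N * t / (M * c\<^sup>2)" and "G2 = N * y / c\<^sup>2"
  obtain v where v: "v \<in> V" using k_small card_V by fastforce
  have "0 < vertex_degree \<F> v" "0 < vertex_degree \<G> v"
    using \<delta>[OF v] \<epsilon>[OF v] assms(5,6) by auto
  then have card_pos: "0 < card \<F>" "0 < card \<G>"
    using vertex_degree_le_card[OF assms(2), of v] vertex_degree_le_card[OF assms(3), of v] by auto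
  have pos: "0 < M" "0 < N" "0 < b" "0 < c" "1 < p" "0 < eigval 0" "real k \<le> p - 1"
    using assms k_small card_pos by (auto simp: M_def N_def b_def c_def p_def eigval_def)
  have nonneg: "0 \<le> s" "0 \<le> t" "0 \<le> x" "0 \<le> y"
    by (auto simp: s_def t_def x_def y_def ip_self_nonneg sum_nonneg)
  have \<sigma>: "\<bar>\<sigma>\<bar> \<le> sqrt (s * t)"
    using Cauchy_Schwarz_ineq_sum[of "degree_dev (ind \<F>)" "degree_dev (ind \<G>)" V]
    unfolding s_def t_def \<sigma>_def by (intro real_le_rsqrt) simp
  have r: "\<bar>r\<bar> \<le> \<bar>eigval 2\<bar> * sqrt (x * y)"
  proof -
    have "r\<^sup>2 \<le> (eigval 2)\<^sup>2 * x * y"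
      unfolding r_def x_def y_def using ip_adj_le[OF orth_below_residual[OF assms(1)]] assms(1) by blast
    then have "\<bar>r\<bar> \<le> sqrt ((eigval 2)\<^sup>2 * (x * y))" by (intro real_le_rsqrt) (simp add: mult_ac)
    then show ?thesis by (simp add: real_sqrt_mult)
  qed
  have "eigval 1 = - (eigval 0 * (real k / p))"
    using binomial_ratios(3)[OF assms(1)] pos by (simp add: p_def field_simps)
  then have ev1: "\<bar>eigval 1\<bar> \<le> eigval 0 * (real k / p)"
    using pos by simp
  have "eigval 2 = eigval 0 * ((real k - 1) / p) * (real k / (p - 1))"
  proof -
    have "eigval 2 * (p * (p - 1)) = eigval 0 * (real k * (real k - 1))"
      using binomial_ratios(4)[OF assms(1)] by (simp add: p_def)
    moreover have "p * (p - 1) \<noteq> 0" using pos by auto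
    ultimately have "eigval 2 = eigval 0 * (real k * (real k - 1)) / (p * (p - 1))"
      by (metis nonzero_eq_divide_eq)
    then show ?thesis by (simp add: mult_ac)
  qed
  \<comment> \<open>This is where \<open>n > 2 * k\<close> is used sharply: \<open>k \<le> p - 1\<close>, with equality for \<open>n = 2 * k + 1\<close>.\<close>
  also have "\<dots> \<le> eigval 0 * ((real k - 1) / p) * 1"
    using pos assms(1) by (intro mult_left_mono) auto
  finally have ev2: "\<bar>eigval 2\<bar> \<le> eigval 0 * ((real k - 1) / p)"
    by (simp add: eigval_def)
  have "0 = eigval 0 * b * c / N + eigval 1 * \<sigma> / M + r"
    using ip_adj_decomposition[OF assms(1), of "ind \<F>" "ind \<G>"] ip_adj_cross_intersecting[OF assms(4)]
    by (simp add: mean_def star_sum_ind_empty assms b_def c_def N_def M_def \<sigma>_def r_def)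
  then have "eigval 0 * b * c / N = - (eigval 1 * \<sigma> / M) - r" by linarith
  also have "\<dots> \<le> \<bar>eigval 1\<bar> * \<bar>\<sigma>\<bar> / M + \<bar>r\<bar>"
    using pos abs_ge_minus_self[of "eigval 1 * \<sigma> / M"] abs_ge_minus_self[of r] by (simp add: abs_mult)
  also have "\<dots> \<le> \<bar>eigval 1\<bar> * sqrt (s * t) / M + \<bar>eigval 2\<bar> * sqrt (x * y)"
    using \<sigma> r pos by (intro add_mono divide_right_mono mult_left_mono) auto
  also have "\<dots> \<le> eigval 0 * (real k / p) * sqrt (s * t) / M + eigval 0 * ((real k - 1) / p) * sqrt (x * y)"
    using ev1 ev2 pos nonneg by (intro add_mono divide_right_mono mult_right_mono) auto
  also have "\<dots> = eigval 0 * ((real k * (sqrt (s * t) / M) + (real k - 1) * sqrt (x * y)) / p)"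
    by (simp add: add_divide_distrib distrib_left mult_ac)
  finally have "eigval 0 * (b * c / N) \<le> eigval 0 * ((real k * (sqrt (s * t) / M) + (real k - 1) * sqrt (x * y)) / p)"
    by (simp add: mult.assoc)
  then have "b * c / N \<le> (real k * (sqrt (s * t) / M) + (real k - 1) * sqrt (x * y)) / p"
    using mult_left_le_imp_le[of "eigval 0"] pos by blast
  then have "p \<le> (real k * (sqrt (s * t) / M) + (real k - 1) * sqrt (x * y)) * (N / (b * c))"
    using pos by (simp add: field_simps)
  also have "\<dots> = real k * sqrt (F1 * G1) + (real k - 1) * sqrt (F2 * G2)"
  proof -
    have "F1 * G1 = (N / (M * b * c))\<^sup>2 * (s * t)" "F2 * G2 = (N / (b * c))\<^sup>2 * (x * y)"
      by (simp_all add: F1_def F2_def G1_def G2_def power2_eq_square mult_ac)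
    then have "sqrt (F1 * G1) = N / (M * b * c) * sqrt (s * t)" "sqrt (F2 * G2) = N / (b * c) * sqrt (x * y)"
      using pos by (simp_all only: real_sqrt_mult real_sqrt_abs) simp_all
    then show ?thesis by (simp add: distrib_left distrib_right add_divide_distrib mult_ac)
  qed
  finally have bound: "p \<le> real k * sqrt (F1 * G1) + (real k - 1) * sqrt (F2 * G2)" .
  have "(\<delta> * p / M) * (\<epsilon> * p / M) \<le> (real k - 1)\<^sup>2"
  proof (rule two_level_optimisation[of "\<delta> * p / M" "\<epsilon> * p / M" F1 F2 G1 G2 "real k - 1" "real n - 1"])
    show "(1 + \<delta> * p / M) * F1 + \<delta> * p / M * F2 \<le> real n - 1 - \<delta> * p / M"
      using weight_bound[OF assms(2,1) \<delta> card_pos(1)]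
      by (simp add: F1_def F2_def M_def N_def b_def s_def x_def p_def)
    show "(1 + \<epsilon> * p / M) * G1 + \<epsilon> * p / M * G2 \<le> real n - 1 - \<epsilon> * p / M"
      using weight_bound[OF assms(3,1) \<epsilon> card_pos(2)]
      by (simp add: G1_def G2_def M_def N_def c_def t_def y_def p_def)
    show "real n - 1 - (real k - 1) \<le> (real k - 1 + 1) * sqrt (F1 * G1) + (real k - 1) * sqrt (F2 * G2)"
      using bound by (simp add: p_def)
  qed (use pos nonneg assms k_small in \<open>auto simp: F1_def F2_def G1_def G2_def\<close>)
  then have "\<delta> * \<epsilon> * p\<^sup>2 \<le> ((real k - 1) * M)\<^sup>2"
    using pos by (simp add: field_simps power2_eq_square)
  also have "(real k - 1) * M = p * real ((n - 2) choose (k - 2))"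
    using binomial_ratios(2)[OF assms(1)] by (simp add: p_def M_def)
  finally have "\<delta> * \<epsilon> * p\<^sup>2 \<le> (real ((n - 2) choose (k - 2)))\<^sup>2 * p\<^sup>2"
    by (simp add: power_mult_distrib mult_ac)
  then show ?thesis using pos by simp
qed

end

lemma min_degree_le: "finite V \<Longrightarrow> i \<in> V \<Longrightarrow> min_degree V \<F> \<le> vertex_degree \<F> i"
  unfolding min_degree_def by (intro Min_le) auto

theorem theorem1p2:
  fixes n k :: nat and \<B> \<C> :: "nat set set"
  assumes "k \<ge> 1" and "n \<ge> 2 * k + 1"
    and "\<B> \<subseteq> nsets {1..n} k" and "\<C> \<subseteq> nsets {1..n} k"
    and "cross_intersecting \<B> \<C>"
  shows "min_degree {1..n} \<B> * min_degree {1..n} \<C> \<le> (binom (n - 2) (int k - 2))\<^sup>2"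
proof (cases "min_degree {1..n} \<B> = 0 \<or> min_degree {1..n} \<C> = 0")
  case True
  then show ?thesis by auto
next
  case False
  have deg: "min_degree {1..n} \<F> \<le> vertex_degree \<F> i" if "i \<in> {1..n}" for \<F> i
    using that by (intro min_degree_le) auto
  show ?thesis
  proof (cases "k = 1")
    case True
    have ex: "\<exists>F\<in>\<F>. i \<in> F" if "min_degree {1..n} \<F> \<noteq> 0" "i \<in> {1..n}" for \<F> :: "nat set set" and i
    proof -
      have "vertex_degree \<F> i \<noteq> 0" using deg[OF that(2), of \<F>] that(1) by linarith
      then have "{F \<in> \<F>. i \<in> F} \<noteq> {}" unfolding vertex_degree_def by (metis card.empty)
      then show ?thesis by blast
    qed
    \<comment> \<open>Each family covers the points 1 and 2 by singletons, so the families contain disjoint members.\<close>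
    obtain B where B: "B \<in> \<B>" "1 \<in> B" using ex[of \<B> 1] False assms(2) by auto
    obtain C where C: "C \<in> \<C>" "2 \<in> C" using ex[of \<C> 2] False assms(2) True by auto
    have "card B = 1" "card C = 1" using B C assms(3,4) True by (auto simp: nsets_def)
    then have "B = {1}" "C = {2}" using B C by (auto simp: card_1_singleton_iff)
    moreover have "B \<inter> C \<noteq> {}" using B C assms(5) by (auto simp: cross_intersecting_def)
    ultimately show ?thesis by simp
  next
    case k: False
    interpret kneser "{1..n}" n k by unfold_locales (use assms in auto)
    have "real (min_degree {1..n} \<B>) * real (min_degree {1..n} \<C>) \<le> (real ((n - 2) choose (k - 2)))\<^sup>2"
      using assms k False deg by (intro degree_product_le[of \<B> \<C>]) auto
    then have "min_degree {1..n} \<B> * min_degree {1..n} \<C> \<le> ((n - 2) choose (k - 2))\<^sup>2"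
      by (metis of_nat_le_iff of_nat_mult of_nat_power)
    moreover have "nat (int k - 2) = k - 2" by simp
    ultimately show ?thesis using k assms(1) by (simp add: binom_def)
  qed
qed

end
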